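(* Consider the discretely monitored up-and-out option in the Black--Scholes model with payoff $$g=\max\left(f(S_1(t_1),\ldots,S_n(t_m)),0\right)\,\mathbb{I}\left\{\max_{j=1,\ldots,m}S_1(t_j)<B\right\},$$ where all asset prices are generated from a random vector $(u_1,\ldots,u_{mn})$ uniformly distributed on $(0,1)^{mn}$ via a matrix $A$ with $AA'=\widetilde\Sigma$ and $a_{j,1}\neq 0$ for $j=1,\ldots,m$. Let $\Upsilon_d=\Upsilon_d(u_2,\ldots,u_{mn})$ and $\Upsilon_u=\Upsilon_u(u_2,\ldots,u_{mn})$ be the lower and upper bounds on $u_1$ implied by the barrier condition, put $\hat u_1=\Upsilon_d+(\Upsilon_u-\Upsilon_d)u_1$, and define $$\hat g_2=\max(\Upsilon_u-\Upsilon_d,0)\,\max\left(f(\hat u_1,u_2,\ldots,u_{mn}),0\right).$$ Then $\hat g_2$ is an unbiased estimator, that is, $\mathbb{E}[g]=\mathbb{E}[\hat g_2]$.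
   Context: Model. Let $n,m\ge 1$ be integers, $r\in\mathbb{R}$, $T>0$, $\Delta t=T/m$, $t_j=j\Delta t$ for $j=0,\ldots,m$. There are $n$ assets with initial prices $S_i(0)>0$, volatilities $\sigma_i>0$ and correlation matrix $(\rho_{ij})$, and $S_i(t)=S_i(0)e^{(r-\sigma_i^2/2)t+\sigma_iW_i(t)}$, where $(W_1,\ldots,W_n)$ is a Brownian motion with $dW_i\,dW_j=\rho_{ij}\,dt$. The vector $\widetilde{W}=(\sigma_1W_1(t_1),\ldots,\sigma_1W_1(t_m),\sigma_2W_2(t_1),\ldots,\sigma_nW_n(t_m))'$ is centred Gaussian with $mn\times mn$ covariance matrix $\widetilde\Sigma$ whose entry for $(\sigma_iW_i(t_k),\sigma_jW_j(t_l))$ is $\rho_{ij}\sigma_i\sigma_j\min(k,l)\Delta t$. Path construction. $A=(a_{j,i})$ is a real $mn\times mn$ matrix with $AA'=\widetilde\Sigma$ (prime denotes transpose). $\Phi$ is the standard normal cumulative distribution function. Given $u=(u_1,\ldots,u_{mn})\in(0,1)^{mn}$, set $z_i=\Phi^{-1}(u_i)$ and $\widetilde{W}=Az$; this determines all prices: $S_i(t_j)=S_i(0)\exp\left((r-\sigma_i^2/2)t_j+(Az)_{(i-1)m+j}\right)$. When $u$ is uniform on $(0,1)^{mn}$ this gives the correct joint law of the prices. $f$ is a real-valued (measurable) function of the prices $(S_i(t_j))_{i,j}$; $f(u_1,\ldots,u_{mn})$ denotes its value at the prices generated from $u$. $B>0$ is the barrier level. Bounds. Let $b(t_j)=\log(B/S_1(0))-(r-\sigma_1^2/2)t_j$,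 and $$q_j(u_2,\ldots,u_{mn})=\frac{b(t_j)-a_{j,2}\Phi^{-1}(u_2)-\cdots-a_{j,mn}\Phi^{-1}(u_{mn})}{a_{j,1}},\qquad j=1,\ldots,m.$$ Let $\mathcal{P}=\{j\in\{1,\ldots,m\}:a_{j,1}>0\}$, so that $a_{j,1}<0$ for $j\in\{1,\ldots,m\}\setminus\mathcal{P}$. Then $\Upsilon_u=\Phi(\min_{j\in\mathcal{P}}q_j)$ (with $\Upsilon_u=1$ if $\mathcal{P}=\emptyset$) and $\Upsilon_d=\Phi(\max_{j\in\{1,\ldots,m\}\setminus\mathcal{P}}q_j)$ (with $\Upsilon_d=0$ if $\mathcal{P}=\{1,\ldots,m\}$). The value of $\hat g_2$ is taken to be $0$ whenever $\Upsilon_u\le\Upsilon_d$. *)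

theory Defs
  imports "HOL-Probability.Probability"
begin

definition std_normal_cdf :: "real \<Rightarrow> real" ("\<Phi>") where
  "\<Phi> = cdf std_normal_distribution"

(* Only meaningful on (0,1), the range of the injective function \<Phi>. *)
definition std_normal_quantile :: "real \<Rightarrow> real" where
  "std_normal_quantile = inv \<Phi>"

definition correlation_matrix :: "nat \<Rightarrow> (nat \<Rightarrow> nat \<Rightarrow> real) \<Rightarrow> bool" where
  "correlation_matrix n \<rho> \<longleftrightarrow>
     (\<forall>i\<in>{1..n}. \<rho> i i = 1) \<and>
     (\<forall>i\<in>{1..n}. \<forall>j\<in>{1..n}. \<rho> i j = \<rho> j i) \<and>
     (\<forall>x :: nat \<Rightarrow> real. 0 \<le> (\<Sum>i=1..n. \<Sum>j=1..n. x i * \<rho> i j * x j))"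

definition obs_time :: "nat \<Rightarrow> real \<Rightarrow> nat \<Rightarrow> real" where
  "obs_time m T j = real j * (T / real m)"

(* All indices are 1-based. The entry \<sigma>\<^sub>i W\<^sub>i(t\<^sub>k) (1 \<le> i \<le> n, 1 \<le> k \<le> m) of the stacked
   path vector sits at position (i - 1) m + k; this enumerates {1..m * n} bijectively. *)
definition path_index :: "nat \<Rightarrow> nat \<Rightarrow> nat \<Rightarrow> nat" where
  "path_index m i k = (i - 1) * m + k"

(* A A' equals the covariance matrix of the stacked path vector, entry by entry. *)
definition generates_covariance ::
  "nat \<Rightarrow> nat \<Rightarrow> real \<Rightarrow> (nat \<Rightarrow> real) \<Rightarrow> (nat \<Rightarrow> nat \<Rightarrow> real) \<Rightarrow> (nat \<Rightarrow> nat \<Rightarrow> real) \<Rightarrow> bool"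
where
  "generates_covariance n m T \<sigma> \<rho> A \<longleftrightarrow>
     (\<forall>i\<in>{1..n}. \<forall>j\<in>{1..n}. \<forall>k\<in>{1..m}. \<forall>l\<in>{1..m}.
        (\<Sum>p=1..m * n. A (path_index m i k) p * A (path_index m j l) p)
          = \<rho> i j * \<sigma> i * \<sigma> j * real (min k l) * (T / real m))"

(* The price array (i, j) \<mapsto> S\<^sub>i(t\<^sub>j) generated from u, as an element of R^({1..n} \<times> {1..m}). *)
definition prices ::
  "nat \<Rightarrow> nat \<Rightarrow> real \<Rightarrow> real \<Rightarrow> (nat \<Rightarrow> real) \<Rightarrow> (nat \<Rightarrow> real) \<Rightarrow> (nat \<Rightarrow> nat \<Rightarrow> real)
     \<Rightarrow> (nat \<Rightarrow> real) \<Rightarrow> nat \<times> nat \<Rightarrow> real"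
where
  "prices n m r T S\<^sub>0 \<sigma> A u =
     (\<lambda>(i, j) \<in> {1..n} \<times> {1..m}.
        S\<^sub>0 i * exp ((r - (\<sigma> i)\<^sup>2 / 2) * obs_time m T j
                  + (\<Sum>l=1..m * n. A (path_index m i j) l * std_normal_quantile (u l))))"

definition up_and_out_payoff ::
  "nat \<Rightarrow> real \<Rightarrow> ((nat \<times> nat \<Rightarrow> real) \<Rightarrow> real) \<Rightarrow> (nat \<times> nat \<Rightarrow> real) \<Rightarrow> real"
where
  "up_and_out_payoff m B f S = max (f S) 0 * of_bool (Max ((\<lambda>j. S (1, j)) ` {1..m}) < B)"

definition log_barrier ::
  "nat \<Rightarrow> real \<Rightarrow> real \<Rightarrow> (nat \<Rightarrow> real) \<Rightarrow> (nat \<Rightarrow> real) \<Rightarrow> real \<Rightarrow> nat \<Rightarrow> real"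
where
  "log_barrier m r T S\<^sub>0 \<sigma> B j = ln (B / S\<^sub>0 1) - (r - (\<sigma> 1)\<^sup>2 / 2) * obs_time m T j"

(* Rows 1..m of A belong to the first asset, as path_index m 1 j = j. *)
definition barrier_threshold ::
  "nat \<Rightarrow> nat \<Rightarrow> real \<Rightarrow> real \<Rightarrow> (nat \<Rightarrow> real) \<Rightarrow> (nat \<Rightarrow> real) \<Rightarrow> (nat \<Rightarrow> nat \<Rightarrow> real) \<Rightarrow> real
     \<Rightarrow> (nat \<Rightarrow> real) \<Rightarrow> nat \<Rightarrow> real"
where
  "barrier_threshold n m r T S\<^sub>0 \<sigma> A B u j =
     (log_barrier m r T S\<^sub>0 \<sigma> B j - (\<Sum>l=2..m * n. A j l * std_normal_quantile (u l))) / A j 1"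

definition positive_rows :: "nat \<Rightarrow> (nat \<Rightarrow> nat \<Rightarrow> real) \<Rightarrow> nat set" where
  "positive_rows m A = {j \<in> {1..m}. A j 1 > 0}"

definition upper_bound ::
  "nat \<Rightarrow> nat \<Rightarrow> real \<Rightarrow> real \<Rightarrow> (nat \<Rightarrow> real) \<Rightarrow> (nat \<Rightarrow> real) \<Rightarrow> (nat \<Rightarrow> nat \<Rightarrow> real) \<Rightarrow> real
     \<Rightarrow> (nat \<Rightarrow> real) \<Rightarrow> real"
where
  "upper_bound n m r T S\<^sub>0 \<sigma> A B u =
     (if positive_rows m A = {} then 1
      else \<Phi> (Min (barrier_threshold n m r T S\<^sub>0 \<sigma> A B u ` positive_rows m A)))"

definition lower_bound ::
  "nat \<Rightarrow> nat \<Rightarrow> real \<Rightarrow> real \<Rightarrow> (nat \<Rightarrow> real) \<Rightarrow> (nat \<Rightarrow> real) \<Rightarrow> (nat \<Rightarrow> nat \<Rightarrow> real) \<Rightarrow> real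
     \<Rightarrow> (nat \<Rightarrow> real) \<Rightarrow> real"
where
  "lower_bound n m r T S\<^sub>0 \<sigma> A B u =
     (if positive_rows m A = {1..m} then 0
      else \<Phi> (Max (barrier_threshold n m r T S\<^sub>0 \<sigma> A B u ` ({1..m} - positive_rows m A))))"

(* If upper_bound \<le> lower_bound the first factor vanishes, so the estimator is 0
   whatever value the (then meaningless) second factor takes. *)
definition conditional_estimator ::
  "nat \<Rightarrow> nat \<Rightarrow> real \<Rightarrow> real \<Rightarrow> (nat \<Rightarrow> real) \<Rightarrow> (nat \<Rightarrow> real) \<Rightarrow> (nat \<Rightarrow> nat \<Rightarrow> real) \<Rightarrow> real
     \<Rightarrow> ((nat \<times> nat \<Rightarrow> real) \<Rightarrow> real) \<Rightarrow> (nat \<Rightarrow> real) \<Rightarrow> real"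
where
  "conditional_estimator n m r T S\<^sub>0 \<sigma> A B f u =
     (let lo = lower_bound n m r T S\<^sub>0 \<sigma> A B u;
          up = upper_bound n m r T S\<^sub>0 \<sigma> A B u;
          u1 = lo + (up - lo) * u 1
      in max (up - lo) 0 * max (f (prices n m r T S\<^sub>0 \<sigma> A (u(1 := u1)))) 0)"

end

theory Submission
  imports Defs
begin

text \<open>
  Condition on $u_2,\dots,u_{mn}$. Since $\Phi^{-1}$ is increasing and $a_{j,1} \neq 0$, the barrier
  condition at $t_j$ is a strict bound on $u_1$; jointly they say that $u_1$ lies in an open interval
  contained in $(0,1)$. On such a slice the estimator is the integrand after the affine substitution
  that maps $(0,1)$ onto this interval, whose Jacobian is the first factor of the estimator. Fubini
  integrates the slicewise equality.
\<close>

section \<open>The standard normal distribution function and its quantile\<close>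

text \<open>If \<open>{x<..y}\<close> had mass zero, the everywhere positive density would force
  almost every point of the line to lie outside the interval, against its positive Lebesgue
  measure.\<close>

lemma strict_mono_std_normal_cdf: "strict_mono \<Phi>"
proof (rule strict_monoI)
  fix x y :: real
  assume "x < y"
  interpret real_distribution std_normal_distribution
    by (rule real_dist_normal_dist)
  have "emeasure std_normal_distribution {x<..y} \<noteq> 0"
  proof
    assume "emeasure std_normal_distribution {x<..y} = 0"
    then have "{x<..y} \<in> null_sets std_normal_distribution"
      by (auto simp: null_sets_def)
    then have "AE z in lborel. z \<in> {x<..y} \<longrightarrow> ennreal (std_normal_density z) \<le> 0"
      by (subst (asm) null_sets_density_iff) auto
    then have "AE z in lborel. z \<notin> {x<..y}"
      by eventually_elim (auto simp: std_normal_density_def)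
    then have "emeasure lborel {x<..y} = 0"
      by (subst (asm) AE_iff_measurable[where N = "{x<..y}"]) auto
    with \<open>x < y\<close> show False by simp
  qed
  then have "measure std_normal_distribution {x<..y} > 0"
    by (simp add: emeasure_eq_measure zero_less_measure_iff)
  with cdf_diff_eq[OF \<open>x < y\<close>] show "\<Phi> x < \<Phi> y"
    by (simp add: std_normal_cdf_def)
qed

text \<open>A distribution function is continuous exactly where its measure has no atom, and a
  measure with a Lebesgue density has none.\<close>

lemma continuous_on_std_normal_cdf: "continuous_on UNIV \<Phi>"
proof -
  interpret real_distribution std_normal_distribution
    by (rule real_dist_normal_dist)
  have "emeasure std_normal_distribution {x} = 0" for x :: real
    by (subst emeasure_density) (auto simp: nn_integral_cmult_indicator)
  then have "measure std_normal_distribution {x} = 0" for x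
    by (simp add: measure_def)
  then show ?thesis
    by (simp add: continuous_on_eq_continuous_at std_normal_cdf_def isCont_cdf)
qed

text \<open>The limits at both ends and the intermediate value theorem give every value strictly
  between 0 and 1. The values 0 and 1 are not attained: by strict monotonicity, moving one unit
  further would leave [0,1].\<close>

lemma range_std_normal_cdf: "range \<Phi> = {0<..<1}"
proof -
  interpret real_distribution std_normal_distribution
    by (rule real_dist_normal_dist)
  have lt: "\<Phi> x < \<Phi> (x + 1)" "\<Phi> (x - 1) < \<Phi> x" for x
    using strict_mono_std_normal_cdf by (auto simp: strict_mono_def)
  have bounds: "0 \<le> \<Phi> x" "\<Phi> x \<le> 1" for x
    unfolding std_normal_cdf_def by (auto intro: cdf_nonneg cdf_bounded_prob)
  have "0 < \<Phi> x" "\<Phi> x < 1" for x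
    using lt[of x] bounds[of "x + 1"] bounds[of "x - 1"] by linarith+
  moreover have "p \<in> range \<Phi>" if p: "0 < p" "p < 1" for p
  proof -
    have "eventually (\<lambda>x. \<Phi> x < p) at_bot"
      using cdf_lim_at_bot p(1) unfolding std_normal_cdf_def by (rule order_tendstoD)
    then obtain a where a: "\<Phi> a < p"
      by (auto simp: eventually_at_bot_linorder)
    have "eventually (\<lambda>x. p < \<Phi> x) at_top"
      using cdf_lim_at_top_prob p(2) unfolding std_normal_cdf_def by (rule order_tendstoD)
    then obtain b where b: "p < \<Phi> b"
      by (auto simp: eventually_at_top_linorder)
    have "a \<le> b"
      using a b strict_mono_less[OF strict_mono_std_normal_cdf, of a b] by linarith
    then obtain x where "\<Phi> x = p"
      using IVT'[of \<Phi> a p b] a b continuous_on_subset[OF continuous_on_std_normal_cdf] by force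
    then show ?thesis by blast
  qed
  ultimately show ?thesis by auto
qed

lemma std_normal_cdf_quantile:
  "p \<in> {0<..<1} \<Longrightarrow> \<Phi> (std_normal_quantile p) = p"
  unfolding std_normal_quantile_def by (rule f_inv_into_f) (simp add: range_std_normal_cdf)

text \<open>Both directions are wanted: the sign of \<open>A j 1\<close> decides which of them a
  monitoring date uses.\<close>

lemma std_normal_quantile_less_iff:
  assumes "p \<in> {0<..<1}"
  shows "std_normal_quantile p < x \<longleftrightarrow> p < \<Phi> x"
    and "x < std_normal_quantile p \<longleftrightarrow> \<Phi> x < p"
  using strict_mono_less[OF strict_mono_std_normal_cdf, of "std_normal_quantile p" x]
    strict_mono_less[OF strict_mono_std_normal_cdf, of x "std_normal_quantile p"]
  by (simp_all add: std_normal_cdf_quantile[OF assms])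

text \<open>Off $(0,1)$ the quantile is an unspecified constant, so it is measurable on the whole line.\<close>

lemma borel_measurable_std_normal_quantile [measurable]:
  "std_normal_quantile \<in> borel_measurable borel"
proof -
  \<comment> \<open>For \<open>p\<close> outside the range of \<Phi>, \<open>inv\<close> chooses
    from a predicate that is false everywhere, so the choice does not depend on
    \<open>p\<close>.\<close>
  define c :: real where "c = (SOME x. False)"
  have c: "std_normal_quantile p = c" if "p \<notin> {0<..<1}" for p
  proof -
    have "\<Phi> x \<noteq> p" for x
      using that range_std_normal_cdf by (metis rangeI)
    then show ?thesis
      by (simp add: std_normal_quantile_def inv_into_def c_def)
  qed
  have "{p. std_normal_quantile p < a} =
      {0<..<1} \<inter> {..<\<Phi> a} \<union> (if c < a then - {0<..<1} else {})"
    (is "?L = ?R") for a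
  proof (rule set_eqI)
    fix p
    show "p \<in> ?L \<longleftrightarrow> p \<in> ?R"
      using c[of p] std_normal_quantile_less_iff(1)[of p a] by (cases "p \<in> {0<..<1}") auto
  qed
  then show ?thesis
    by (intro borel_measurable_iff_less[THEN iffD2]) auto
qed

section \<open>Integration over the unit cube and change of variables on a slice\<close>

text \<open>Tonelli in the form needed for conditioning: one coordinate is integrated innermost, the
  others are held fixed.\<close>

lemma nn_integral_uniform_unit_cube_insert:
  fixes h :: "('i \<Rightarrow> real) \<Rightarrow> ennreal"
  assumes "finite I" and "i \<notin> I"
    and h: "h \<in> borel_measurable (\<Pi>\<^sub>M l\<in>insert i I. borel)"
  shows "(\<integral>\<^sup>+u. h u \<partial>uniform_measure (\<Pi>\<^sub>M l\<in>insert i I. lborel) (\<Pi>\<^sub>E l\<in>insert i I. {0<..<1})) =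
    (\<integral>\<^sup>+u. (\<integral>\<^sup>+y. h (u(i := y)) * indicator {0<..<1} y \<partial>lborel)
        * indicator (\<Pi>\<^sub>E l\<in>I. {0<..<1}) u \<partial>(\<Pi>\<^sub>M l\<in>I. lborel))"
proof -
  interpret product_sigma_finite "\<lambda>_::'i. lborel :: real measure" ..
  let ?P = "\<Pi>\<^sub>M l\<in>insert i I. lborel :: real measure"
  let ?C = "\<Pi>\<^sub>E l\<in>insert i I. {0<..<1::real}"
  have sets: "sets ?P = sets (\<Pi>\<^sub>M l\<in>insert i I. borel)"
    by (intro sets_PiM_cong) auto
  have h': "h \<in> borel_measurable ?P"
    using h by (simp cong: measurable_cong_sets add: measurable_cong_sets[OF sets refl])
  have C: "?C \<in> sets ?P"
    using \<open>finite I\<close> by (intro sets_PiM_I_finite) auto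
  \<comment> \<open>With volume 1 the uniform measure needs no normalisation and is Lebesgue measure
    restricted to the cube.\<close>
  have "emeasure ?P ?C = 1"
    using \<open>finite I\<close> by (subst emeasure_PiM) auto
  then have "(\<integral>\<^sup>+u. h u \<partial>uniform_measure ?P ?C) = (\<integral>\<^sup>+u. h u * indicator ?C u \<partial>?P)"
    using h' C by (simp add: nn_integral_uniform_measure divide_ennreal_def)
  also have "\<dots> = (\<integral>\<^sup>+u. (\<integral>\<^sup>+y. h (u(i := y)) * indicator ?C (u(i := y)) \<partial>lborel) \<partial>(\<Pi>\<^sub>M l\<in>I. lborel))"
    using assms(1,2) h' C by (intro product_nn_integral_insert) auto
  also have "\<dots> = (\<integral>\<^sup>+u. (\<integral>\<^sup>+y. h (u(i := y)) * indicator {0<..<1} y \<partial>lborel)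
        * indicator (\<Pi>\<^sub>E l\<in>I. {0<..<1}) u \<partial>(\<Pi>\<^sub>M l\<in>I. lborel))"
  proof (rule nn_integral_cong)
    fix u :: "'i \<Rightarrow> real"
    assume u: "u \<in> space (\<Pi>\<^sub>M l\<in>I. lborel)"
    \<comment> \<open>The indicator of the cube factorises because points of the product space are
      extensional and \<open>i\<close> is a fresh index.\<close>
    then have "indicator ?C (u(i := y)) =
        (indicator {0<..<1} y * indicator (\<Pi>\<^sub>E l\<in>I. {0<..<1}) u :: ennreal)" for y
      using \<open>i \<notin> I\<close> by (auto simp: indicator_def space_PiM PiE_iff extensional_def)
    moreover have "(\<lambda>y. h (u(i := y))) \<in> borel_measurable lborel"
      using h' u \<open>i \<notin> I\<close> measurable_comp[OF measurable_component_update h'] by (simp add: comp_def)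
    ultimately show "(\<integral>\<^sup>+y. h (u(i := y)) * indicator ?C (u(i := y)) \<partial>lborel) =
        (\<integral>\<^sup>+y. h (u(i := y)) * indicator {0<..<1} y \<partial>lborel) * indicator (\<Pi>\<^sub>E l\<in>I. {0<..<1}) u"
      by (subst nn_integral_multc[symmetric]) (auto simp: mult.assoc)
  qed
  finally show ?thesis .
qed

text \<open>For \<open>lo < up\<close> this is the affine substitution from (0,1) onto
  (\<open>lo\<close>, \<open>up\<close>); otherwise both integrands vanish. The hypotheses on
  \<open>lo\<close> and \<open>up\<close> keep the target interval inside the unit interval, so that
  its indicator absorbs the other one.\<close>

lemma nn_integral_stretch_unit_interval:
  fixes F :: "real \<Rightarrow> real"
  assumes F [measurable]: "F \<in> borel_measurable borel" and lo: "0 \<le> lo" and up: "up \<le> 1"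
  shows "(\<integral>\<^sup>+y. ennreal (max (up - lo) 0 * F (lo + (up - lo) * y)) * indicator {0<..<1} y \<partial>lborel) =
    (\<integral>\<^sup>+y. ennreal (F y * of_bool (lo < y \<and> y < up)) * indicator {0<..<1} y \<partial>lborel)"
proof (cases "lo < up")
  case False
  then show ?thesis by (intro nn_integral_cong) auto
next
  case True
  have "(\<integral>\<^sup>+y. ennreal (F y * of_bool (lo < y \<and> y < up)) * indicator {0<..<1} y \<partial>lborel) =
      (\<integral>\<^sup>+y. ennreal (F y) * indicator {lo<..<up} y \<partial>lborel)"
    using lo up by (intro nn_integral_cong) (auto simp: indicator_def)
  \<comment> \<open>The Jacobian of the substitution is the factor \<open>max (up - lo) 0\<close> of
    the estimator.\<close>
  also have "\<dots> = \<bar>up - lo\<bar> * (\<integral>\<^sup>+y. ennreal (F (lo + (up - lo) * y)) *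
      indicator {lo<..<up} (lo + (up - lo) * y) \<partial>lborel)"
    using True by (intro nn_integral_real_affine) auto
  also have "\<dots> = (\<integral>\<^sup>+y. ennreal (max (up - lo) 0 * F (lo + (up - lo) * y)) *
      indicator {0<..<1} y \<partial>lborel)"
  proof -
    have "indicator {lo<..<up} (lo + (up - lo) * y) = (indicator {0<..<1} y :: ennreal)" for y
    proof -
      have "lo < lo + (up - lo) * y \<longleftrightarrow> 0 < y"
        using True by (simp add: zero_less_mult_iff)
      \<comment> \<open>The factor 1 on the right gives both sides the common positive factor that
        is cancelled next.\<close>
      moreover have "lo + (up - lo) * y < up \<longleftrightarrow> (up - lo) * y < (up - lo) * 1"
        by auto
      then have "lo + (up - lo) * y < up \<longleftrightarrow> y < 1"
        using True by (simp only: mult_less_cancel_left_pos diff_gt_0_iff_gt)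
      ultimately show ?thesis by (simp add: indicator_def)
    qed
    then show ?thesis
      using True by (subst nn_integral_cmult[symmetric]) (auto simp: ennreal_mult' mult.assoc)
  qed
  finally show ?thesis by simp
qed


section \<open>Measurability of the prices, the payoff, the bounds and the estimator\<close>

lemma measurable_prices [measurable]:
  "prices n m r T S\<^sub>0 \<sigma> A \<in>
     (\<Pi>\<^sub>M l\<in>{1..m * n}. borel) \<rightarrow>\<^sub>M (\<Pi>\<^sub>M p\<in>{1..n} \<times> {1..m}. borel)"
  unfolding prices_def[abs_def] by measurable

lemma borel_measurable_up_and_out_payoff:
  assumes "n \<ge> 1" and [measurable]: "f \<in> borel_measurable (\<Pi>\<^sub>M p\<in>{1..n} \<times> {1..m}. borel)"
  shows "up_and_out_payoff m B f \<in> borel_measurable (\<Pi>\<^sub>M p\<in>{1..n} \<times> {1..m}. borel)"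
proof -
  \<comment> \<open>Since \<open>n \<ge> 1\<close>, each pair \<open>(1, j)\<close> is a coordinate
    of the price array.\<close>
  have [measurable]: "(\<lambda>S. Max ((\<lambda>j. S (1, j)) ` {1..m})) \<in>
      borel_measurable (\<Pi>\<^sub>M p\<in>{1..n} \<times> {1..m}. borel :: real measure)"
    using \<open>n \<ge> 1\<close> by (intro borel_measurable_Max) auto
  show ?thesis
    unfolding up_and_out_payoff_def[abs_def] by measurable
qed

lemma borel_measurable_barrier_threshold:
  "(\<lambda>u. barrier_threshold n m r T S\<^sub>0 \<sigma> A B u j) \<in> borel_measurable (\<Pi>\<^sub>M l\<in>{1..m * n}. borel)"
  unfolding barrier_threshold_def by measurable

lemma borel_measurable_std_normal_cdf [measurable]: "\<Phi> \<in> borel_measurable borel"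
  by (rule borel_measurable_continuous_onI[OF continuous_on_std_normal_cdf])

lemma borel_measurable_upper_bound [measurable]:
  "upper_bound n m r T S\<^sub>0 \<sigma> A B \<in> borel_measurable (\<Pi>\<^sub>M l\<in>{1..m * n}. borel)"
proof -
  have [measurable]: "(\<lambda>u. Min (barrier_threshold n m r T S\<^sub>0 \<sigma> A B u ` positive_rows m A))
      \<in> borel_measurable (\<Pi>\<^sub>M l\<in>{1..m * n}. borel)"
    by (intro borel_measurable_Min borel_measurable_barrier_threshold) (simp add: positive_rows_def)
  show ?thesis unfolding upper_bound_def[abs_def] by measurable
qed

lemma borel_measurable_lower_bound [measurable]:
  "lower_bound n m r T S\<^sub>0 \<sigma> A B \<in> borel_measurable (\<Pi>\<^sub>M l\<in>{1..m * n}. borel)"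
proof -
  have [measurable]: "(\<lambda>u. Max (barrier_threshold n m r T S\<^sub>0 \<sigma> A B u ` ({1..m} - positive_rows m A)))
      \<in> borel_measurable (\<Pi>\<^sub>M l\<in>{1..m * n}. borel)"
    by (intro borel_measurable_Max borel_measurable_barrier_threshold) simp
  show ?thesis unfolding lower_bound_def[abs_def] by measurable
qed

text \<open>The claim concerns all real vectors, for which the rescaled first coordinate may leave
  (0,1); measurability of the quantile on the whole line covers this.\<close>

lemma borel_measurable_conditional_estimator:
  assumes "n \<ge> 1" "m \<ge> 1"
    and [measurable]: "f \<in> borel_measurable (\<Pi>\<^sub>M p\<in>{1..n} \<times> {1..m}. borel)"
  shows "conditional_estimator n m r T S\<^sub>0 \<sigma> A B f \<in> borel_measurable (\<Pi>\<^sub>M l\<in>{1..m * n}. borel)"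
proof -
  have one: "1 \<in> {1..m * n}"
    using assms(1,2) by simp
  have [measurable]: "(\<lambda>u. u 1) \<in> borel_measurable (\<Pi>\<^sub>M l\<in>{1..m * n}. borel :: real measure)"
    using one by (rule measurable_component_singleton)
  define u\<^sub>1 where "u\<^sub>1 u = lower_bound n m r T S\<^sub>0 \<sigma> A B u +
      (upper_bound n m r T S\<^sub>0 \<sigma> A B u - lower_bound n m r T S\<^sub>0 \<sigma> A B u) * u 1" for u
  have u\<^sub>1 [measurable]: "u\<^sub>1 \<in> borel_measurable (\<Pi>\<^sub>M l\<in>{1..m * n}. borel)"
    unfolding u\<^sub>1_def[abs_def] by measurable
  have [measurable]: "(\<lambda>u. u(1 := u\<^sub>1 u)) \<in>
      (\<Pi>\<^sub>M l\<in>{1..m * n}. borel) \<rightarrow>\<^sub>M (\<Pi>\<^sub>M l\<in>{1..m * n}. borel)"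
    using one u\<^sub>1 by (intro measurable_fun_upd[where J = "{1..m * n}"]) auto
  show ?thesis
    unfolding conditional_estimator_def[abs_def] Let_def u\<^sub>1_def[symmetric] by measurable
qed

section \<open>The barrier condition as an interval for the first coordinate\<close>

text \<open>The sum in \<open>barrier_threshold\<close> starts at 2, so the first coordinate is
  never read. Hence both bounds are constants on a slice.\<close>

lemma bounds_fun_upd_1:
  "lower_bound n m r T S\<^sub>0 \<sigma> A B (u(1 := y)) = lower_bound n m r T S\<^sub>0 \<sigma> A B u"
  "upper_bound n m r T S\<^sub>0 \<sigma> A B (u(1 := y)) = upper_bound n m r T S\<^sub>0 \<sigma> A B u"
proof -
  have "barrier_threshold n m r T S\<^sub>0 \<sigma> A B (u(1 := y)) = barrier_threshold n m r T S\<^sub>0 \<sigma> A B u"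
    unfolding barrier_threshold_def by (intro ext) (auto intro!: arg_cong2[where f = "(/)"] sum.cong)
  then show "lower_bound n m r T S\<^sub>0 \<sigma> A B (u(1 := y)) = lower_bound n m r T S\<^sub>0 \<sigma> A B u"
    and "upper_bound n m r T S\<^sub>0 \<sigma> A B (u(1 := y)) = upper_bound n m r T S\<^sub>0 \<sigma> A B u"
    by (simp_all add: lower_bound_def upper_bound_def)
qed

lemma std_normal_cdf_bounds: "0 < \<Phi> x" "\<Phi> x < 1"
  using range_std_normal_cdf rangeI[of \<Phi> x] by auto

lemma lower_bound_nonneg: "0 \<le> lower_bound n m r T S\<^sub>0 \<sigma> A B u"
  and upper_bound_le_1: "upper_bound n m r T S\<^sub>0 \<sigma> A B u \<le> 1"
  by (auto simp: lower_bound_def upper_bound_def intro: less_imp_le std_normal_cdf_bounds)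

text \<open>Take logarithms, isolate the term of the first coordinate and divide by
  \<open>A j 1\<close>, whose sign fixes the direction of the inequality; then pass from quantiles
  to probabilities.\<close>

lemma price_less_barrier_iff:
  assumes "n \<ge> 1" "m \<ge> 1" "B > 0" "S\<^sub>0 1 > 0" "j \<in> {1..m}" "A j 1 \<noteq> 0" "u 1 \<in> {0<..<1}"
  shows "prices n m r T S\<^sub>0 \<sigma> A u (1, j) < B \<longleftrightarrow>
    (if A j 1 > 0 then u 1 < \<Phi> (barrier_threshold n m r T S\<^sub>0 \<sigma> A B u j)
     else \<Phi> (barrier_threshold n m r T S\<^sub>0 \<sigma> A B u j) < u 1)"
proof -
  let ?z = "\<lambda>l. std_normal_quantile (u l)" and ?q = "barrier_threshold n m r T S\<^sub>0 \<sigma> A B u j"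
  let ?c = "(r - (\<sigma> 1)\<^sup>2 / 2) * obs_time m T j" and ?s = "\<Sum>l=2..m * n. A j l * ?z l"
  have I: "{1..m * n} = insert 1 {2..m * n}"
    using assms(1,2) by (auto simp: Suc_le_eq)
  have "(\<Sum>l=1..m * n. A j l * ?z l) = A j 1 * ?z 1 + ?s"
    unfolding I by simp
  then have "prices n m r T S\<^sub>0 \<sigma> A u (1, j) = S\<^sub>0 1 * exp (?c + (A j 1 * ?z 1 + ?s))"
    using assms by (simp add: prices_def path_index_def)
  also have "\<dots> < B \<longleftrightarrow> exp (?c + (A j 1 * ?z 1 + ?s)) < exp (ln (B / S\<^sub>0 1))"
    using assms by (simp add: field_simps)
  \<comment> \<open>Keeping the factor \<open>A j 1\<close> on both sides postpones the case
    distinction on its sign.\<close>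
  also have "\<dots> \<longleftrightarrow> ?z 1 * A j 1 < ?q * A j 1"
    unfolding exp_less_cancel_iff using \<open>A j 1 \<noteq> 0\<close>
    by (simp add: barrier_threshold_def log_barrier_def del: One_nat_def) (auto simp: mult.commute)
  also have "\<dots> \<longleftrightarrow> (if A j 1 > 0 then ?z 1 < ?q else ?q < ?z 1)"
    using \<open>A j 1 \<noteq> 0\<close> by (auto simp: mult_less_cancel_right)
  finally show ?thesis
    using assms by (simp add: std_normal_quantile_less_iff)
qed

text \<open>The maximum is below the barrier iff every date is. The dates with positive
  \<open>A j 1\<close> combine to the upper bound, the remaining ones to the lower bound.\<close>

lemma up_and_out_payoff_prices_eq:
  assumes "n \<ge> 1" "m \<ge> 1" "B > 0" "S\<^sub>0 1 > 0" "\<forall>j\<in>{1..m}. A j 1 \<noteq> 0" "u 1 \<in> {0<..<1}"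
  shows "up_and_out_payoff m B f (prices n m r T S\<^sub>0 \<sigma> A u) =
    max (f (prices n m r T S\<^sub>0 \<sigma> A u)) 0 *
    of_bool (lower_bound n m r T S\<^sub>0 \<sigma> A B u < u 1 \<and> u 1 < upper_bound n m r T S\<^sub>0 \<sigma> A B u)"
proof -
  let ?q = "barrier_threshold n m r T S\<^sub>0 \<sigma> A B u" and ?P = "positive_rows m A"
  have mono: "mono \<Phi>"
    by (rule strict_mono_mono[OF strict_mono_std_normal_cdf])
  have P: "finite ?P" "?P \<subseteq> {1..m}"
    by (auto simp: positive_rows_def)
  \<comment> \<open>The monotone function \<Phi> commutes with \<open>Min\<close>. If there are no
    positive rows, the default bound 1 is harmless because \<open>u 1 < 1\<close>.\<close>
  have up: "u 1 < upper_bound n m r T S\<^sub>0 \<sigma> A B u \<longleftrightarrow> (\<forall>j\<in>?P. u 1 < \<Phi> (?q j))"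
  proof (cases "?P = {}")
    case False
    then show ?thesis
      using P by (simp add: upper_bound_def mono_Min_commute[OF mono])
  qed (use assms in \<open>auto simp: upper_bound_def\<close>)
  \<comment> \<open>Dually with \<open>Max\<close>; here the default is 0, and
    \<open>u 1 > 0\<close>.\<close>
  have lo: "lower_bound n m r T S\<^sub>0 \<sigma> A B u < u 1 \<longleftrightarrow> (\<forall>j\<in>{1..m} - ?P. \<Phi> (?q j) < u 1)"
  proof (cases "?P = {1..m}")
    case False
    then have "{1..m} - ?P \<noteq> {}" using P by auto
    then have "lower_bound n m r T S\<^sub>0 \<sigma> A B u = Max (\<Phi> ` ?q ` ({1..m} - ?P))"
      using False by (simp add: lower_bound_def mono_Max_commute[OF mono])
    with \<open>{1..m} - ?P \<noteq> {}\<close> show ?thesis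
      by (simp del: Diff_eq_empty_iff)
  qed (use assms in \<open>auto simp: lower_bound_def\<close>)
  have "Max ((\<lambda>j. prices n m r T S\<^sub>0 \<sigma> A u (1, j)) ` {1..m}) < B \<longleftrightarrow>
      (\<forall>j\<in>{1..m}. prices n m r T S\<^sub>0 \<sigma> A u (1, j) < B)"
    using \<open>m \<ge> 1\<close> by (subst Max_less_iff) auto
  also have "\<dots> \<longleftrightarrow> (\<forall>j\<in>{1..m}. if A j 1 > 0 then u 1 < \<Phi> (?q j) else \<Phi> (?q j) < u 1)"
    using assms by (intro ball_cong refl price_less_barrier_iff) auto
  also have "\<dots> \<longleftrightarrow> lower_bound n m r T S\<^sub>0 \<sigma> A B u < u 1 \<and> u 1 < upper_bound n m r T S\<^sub>0 \<sigma> A B u"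
    unfolding up lo positive_rows_def by (smt (verit) Diff_iff mem_Collect_eq)
  finally show ?thesis
    by (simp add: up_and_out_payoff_def)
qed

section \<open>Equality on each slice and of the expectations\<close>

lemma nn_integral_slice_eq:
  fixes f :: "(nat \<times> nat \<Rightarrow> real) \<Rightarrow> real"
  assumes "n \<ge> 1" "m \<ge> 1" "B > 0" "S\<^sub>0 1 > 0" "\<forall>j\<in>{1..m}. A j 1 \<noteq> 0"
    and [measurable]: "f \<in> borel_measurable (\<Pi>\<^sub>M p\<in>{1..n} \<times> {1..m}. borel)"
    and u: "u \<in> extensional {2..m * n}"
  shows "(\<integral>\<^sup>+y. ennreal (up_and_out_payoff m B f (prices n m r T S\<^sub>0 \<sigma> A (u(1 := y))))
        * indicator {0<..<1} y \<partial>lborel) =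
    (\<integral>\<^sup>+y. ennreal (conditional_estimator n m r T S\<^sub>0 \<sigma> A B f (u(1 := y)))
        * indicator {0<..<1} y \<partial>lborel)"
proof -
  define F where "F y = max (f (prices n m r T S\<^sub>0 \<sigma> A (u(1 := y)))) 0" for y
  let ?lo = "lower_bound n m r T S\<^sub>0 \<sigma> A B u" and ?up = "upper_bound n m r T S\<^sub>0 \<sigma> A B u"
  have I: "{1..m * n} = insert 1 {2..m * n}"
    using assms(1,2) by (auto simp: Suc_le_eq)
  \<comment> \<open>Extensionality of \<open>u\<close> on the remaining indices makes
    \<open>u(1 := y)\<close> a point of the full product space.\<close>
  have [measurable]: "(\<lambda>y. u(1 := y)) \<in> borel \<rightarrow>\<^sub>M (\<Pi>\<^sub>M l\<in>{1..m * n}. borel)"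
    using u unfolding I by (intro measurable_component_update) (auto simp: space_PiM PiE_def)
  have F: "F \<in> borel_measurable borel"
    unfolding F_def[abs_def] by measurable
  have "(\<integral>\<^sup>+y. ennreal (up_and_out_payoff m B f (prices n m r T S\<^sub>0 \<sigma> A (u(1 := y))))
        * indicator {0<..<1} y \<partial>lborel) =
      (\<integral>\<^sup>+y. ennreal (F y * of_bool (?lo < y \<and> y < ?up)) * indicator {0<..<1} y \<partial>lborel)"
  proof (rule nn_integral_cong)
    fix y :: real
    \<comment> \<open>The interval description of the payoff holds only for \<open>y\<close> in
      (0,1); elsewhere the indicator makes both sides zero.\<close>
    show "ennreal (up_and_out_payoff m B f (prices n m r T S\<^sub>0 \<sigma> A (u(1 := y)))) * indicator {0<..<1} y
        = ennreal (F y * of_bool (?lo < y \<and> y < ?up)) * indicator {0<..<1} y"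
    proof (cases "y \<in> {0<..<1}")
      case True
      then show ?thesis
        using assms by (subst up_and_out_payoff_prices_eq[where B = B]) (auto simp: F_def bounds_fun_upd_1 simp del: One_nat_def)
    qed simp
  qed
  also have "\<dots> = (\<integral>\<^sup>+y. ennreal (max (?up - ?lo) 0 * F (?lo + (?up - ?lo) * y))
      * indicator {0<..<1} y \<partial>lborel)"
    by (rule nn_integral_stretch_unit_interval[OF F lower_bound_nonneg upper_bound_le_1, symmetric])
  \<comment> \<open>The bounds do not change under the update by \<open>y\<close>, and the second
    update of coordinate 1 overwrites the first.\<close>
  also have "\<dots> = (\<integral>\<^sup>+y. ennreal (conditional_estimator n m r T S\<^sub>0 \<sigma> A B f (u(1 := y)))
        * indicator {0<..<1} y \<partial>lborel)"
    by (simp add: conditional_estimator_def Let_def F_def bounds_fun_upd_1 del: One_nat_def)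
  finally show ?thesis .
qed

theorem theorem3:
  fixes n m :: nat and r T B :: real
    and S\<^sub>0 \<sigma> :: "nat \<Rightarrow> real" and \<rho> A :: "nat \<Rightarrow> nat \<Rightarrow> real"
    and f :: "(nat \<times> nat \<Rightarrow> real) \<Rightarrow> real"
    and M :: "'a measure" and U :: "'a \<Rightarrow> nat \<Rightarrow> real"
  assumes "n \<ge> 1" and "m \<ge> 1" and "T > 0" and "B > 0"
    and "\<forall>i\<in>{1..n}. S\<^sub>0 i > 0" and "\<forall>i\<in>{1..n}. \<sigma> i > 0"
    and "correlation_matrix n \<rho>"
    and "generates_covariance n m T \<sigma> \<rho> A"
    and "\<forall>j\<in>{1..m}. A j 1 \<noteq> 0"
    and "f \<in> borel_measurable (\<Pi>\<^sub>M p\<in>{1..n} \<times> {1..m}. borel)"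
    and "prob_space M"
    and "U \<in> measurable M (\<Pi>\<^sub>M l\<in>{1..m * n}. borel)"
    and "distr M (\<Pi>\<^sub>M l\<in>{1..m * n}. borel) U
           = uniform_measure (\<Pi>\<^sub>M l\<in>{1..m * n}. lborel) (\<Pi>\<^sub>E l\<in>{1..m * n}. {0<..<1})"
  defines "g \<equiv> (\<lambda>\<omega>. up_and_out_payoff m B f (prices n m r T S\<^sub>0 \<sigma> A (U \<omega>)))"
    and "g\<^sub>2 \<equiv> (\<lambda>\<omega>. conditional_estimator n m r T S\<^sub>0 \<sigma> A B f (U \<omega>))"
  shows "(\<integral>\<^sup>+\<omega>. ennreal (g \<omega>) \<partial>M) = (\<integral>\<^sup>+\<omega>. ennreal (g\<^sub>2 \<omega>) \<partial>M)
    \<and> (integrable M g \<longleftrightarrow> integrable M g\<^sub>2)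
    \<and> prob_space.expectation M g = prob_space.expectation M g\<^sub>2"
proof -
  interpret prob_space M by fact
  let ?C = "\<Pi>\<^sub>M l\<in>{1..m * n}. borel :: real measure"
  define G where "G u = up_and_out_payoff m B f (prices n m r T S\<^sub>0 \<sigma> A u)" for u
  define G\<^sub>2 where "G\<^sub>2 = conditional_estimator n m r T S\<^sub>0 \<sigma> A B f"
  note U = \<open>U \<in> measurable M ?C\<close> and f = \<open>f \<in> borel_measurable _\<close>
  have I: "{1..m * n} = insert 1 {2..m * n}"
    using \<open>n \<ge> 1\<close> \<open>m \<ge> 1\<close> by (auto simp: Suc_le_eq)
  have G: "G \<in> borel_measurable ?C"
    unfolding G_def[abs_def] using borel_measurable_up_and_out_payoff[OF \<open>n \<ge> 1\<close> f]
    by (rule measurable_compose[OF measurable_prices])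
  have G\<^sub>2: "G\<^sub>2 \<in> borel_measurable ?C"
    unfolding G\<^sub>2_def by (rule borel_measurable_conditional_estimator) fact+
  \<comment> \<open>Transfer to the law of \<open>U\<close>, then split off coordinate 1. The
    formula is stated for general \<open>h\<close> so that it serves both payoffs.\<close>
  have law: "(\<integral>\<^sup>+\<omega>. ennreal (h (U \<omega>)) \<partial>M) =
      (\<integral>\<^sup>+u. (\<integral>\<^sup>+y. ennreal (h (u(1 := y))) * indicator {0<..<1} y \<partial>lborel)
        * indicator (\<Pi>\<^sub>E l\<in>{2..m * n}. {0<..<1}) u \<partial>(\<Pi>\<^sub>M l\<in>{2..m * n}. lborel))"
    if h: "h \<in> borel_measurable ?C" for h
  proof -
    have "(\<integral>\<^sup>+\<omega>. ennreal (h (U \<omega>)) \<partial>M) = (\<integral>\<^sup>+u. ennreal (h u) \<partial>distr M ?C U)"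
      using h by (intro nn_integral_distr[symmetric] U) auto
    also have "\<dots> = (\<integral>\<^sup>+u. (\<integral>\<^sup>+y. ennreal (h (u(1 := y))) * indicator {0<..<1} y \<partial>lborel)
        * indicator (\<Pi>\<^sub>E l\<in>{2..m * n}. {0<..<1}) u \<partial>(\<Pi>\<^sub>M l\<in>{2..m * n}. lborel))"
      unfolding assms(13) using h unfolding I by (intro nn_integral_uniform_unit_cube_insert) auto
    finally show ?thesis .
  qed
  have nn: "(\<integral>\<^sup>+\<omega>. ennreal (g \<omega>) \<partial>M) = (\<integral>\<^sup>+\<omega>. ennreal (g\<^sub>2 \<omega>) \<partial>M)"
  proof -
    have "(\<integral>\<^sup>+\<omega>. ennreal (G (U \<omega>)) \<partial>M) = (\<integral>\<^sup>+\<omega>. ennreal (G\<^sub>2 (U \<omega>)) \<partial>M)"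
      unfolding law[OF G] law[OF G\<^sub>2]
    \<comment> \<open>The indicator of the remaining cube is common to both sides, so comparing the
      inner integrals suffices.\<close>
    proof (rule nn_integral_cong, rule arg_cong2[where f = "(*)", OF _ refl])
      fix u :: "nat \<Rightarrow> real"
      assume "u \<in> space (\<Pi>\<^sub>M l\<in>{2..m * n}. lborel)"
      then have "u \<in> extensional {2..m * n}"
        by (simp add: space_PiM PiE_def)
      then show "(\<integral>\<^sup>+y. ennreal (G (u(1 := y))) * indicator {0<..<1} y \<partial>lborel) =
          (\<integral>\<^sup>+y. ennreal (G\<^sub>2 (u(1 := y))) * indicator {0<..<1} y \<partial>lborel)"
        unfolding G_def G\<^sub>2_def using assms by (intro nn_integral_slice_eq) auto
    qed
    then show ?thesis by (simp add: g_def g\<^sub>2_def G_def G\<^sub>2_def)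
  qed
  have meas: "g \<in> borel_measurable M" "g\<^sub>2 \<in> borel_measurable M"
    using measurable_compose[OF U G] measurable_compose[OF U G\<^sub>2]
    by (simp_all add: g_def g\<^sub>2_def G_def G\<^sub>2_def)
  \<comment> \<open>For nonnegative functions, integrability and the Bochner integral are determined
    by the nonnegative integral, so both remaining claims follow from \<open>nn\<close>.\<close>
  have nonneg: "0 \<le> g \<omega>" "0 \<le> g\<^sub>2 \<omega>" for \<omega>
    by (simp_all add: g_def g\<^sub>2_def up_and_out_payoff_def conditional_estimator_def Let_def)
  have "integrable M g \<longleftrightarrow> integrable M g\<^sub>2"
    using nn meas nonneg by (simp add: integrable_iff_bounded)
  moreover have "expectation g = expectation g\<^sub>2"
    using nn meas nonneg by (simp add: integral_eq_nn_integral)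
  ultimately show ?thesis
    using nn by blast
qed

end
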